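(* The expected number of steps taken before a growing self-avoiding walk (GSAW) on the bi-infinite triangular ladder $\Delta_\infty$ terminates is $941/48\approx 19.6$, with variance $51919/256\approx 202.8$ (standard deviation $\approx 14.2$).
   Context: $\Delta_\infty$ is the graph with vertex set $\{(a,b): a\in\mathbb{Z},\ b\in\{0,1\},\ a+b \text{ even}\}$, where $(x_1,y_1)$ and $(x_2,y_2)$ are adjacent iff ($|x_1-x_2|=1$ and $|y_1-y_2|=1$) or ($y_1=y_2$ and $|x_1-x_2|=2$). All starting vertices are equivalent by symmetry. A growing self-avoiding walk (GSAW) on a graph is the random process that starts at a given vertex and at each step moves to a vertex chosen uniformly at random among the neighbors of the current vertex that have not yet been visited; it terminates (is trapped) when the current vertex has no unvisited neighbor. *)

theory Defs
  imports "HOL-Probability.SPMF"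
begin

text \<open>
  A graph is given by a vertex set \<open>V\<close> and an adjacency relation \<open>adj\<close>.
  A walk is the list of its visited vertices, most recent first, so that its head is
  the current vertex.
\<close>

definition unvisited_neighbors :: "'a set \<Rightarrow> ('a \<Rightarrow> 'a \<Rightarrow> bool) \<Rightarrow> 'a list \<Rightarrow> 'a set" where
  "unvisited_neighbors V adj p = {w \<in> V. adj (hd p) w \<and> w \<notin> set p}"

text \<open>
  The continuation of a growing self-avoiding walk from the walk \<open>p\<close> made so far, as a
  distribution on complete (trapped) walks.  It is a subprobability: the mass missing
  from 1 is the probability that the walk never terminates.  The definition is meant for
  locally finite graphs.
\<close>

partial_function (spmf) gsaw_from ::
    "'a set \<Rightarrow> ('a \<Rightarrow> 'a \<Rightarrow> bool) \<Rightarrow> 'a list \<Rightarrow> 'a list spmf" where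
  "gsaw_from V adj p =
     (if unvisited_neighbors V adj p = {} then return_spmf p
      else bind_spmf (spmf_of_set (unvisited_neighbors V adj p))
             (\<lambda>w. gsaw_from V adj (w # p)))"

definition gsaw :: "'a set \<Rightarrow> ('a \<Rightarrow> 'a \<Rightarrow> bool) \<Rightarrow> 'a \<Rightarrow> 'a list spmf" where
  "gsaw V adj v = gsaw_from V adj [v]"

text \<open>A walk with \<open>n + 1\<close> vertices has made \<open>n\<close> steps.\<close>

definition gsaw_steps :: "'a set \<Rightarrow> ('a \<Rightarrow> 'a \<Rightarrow> bool) \<Rightarrow> 'a \<Rightarrow> nat spmf" where
  "gsaw_steps V adj v = map_spmf (\<lambda>p. length p - 1) (gsaw V adj v)"

definition tri_ladder_verts :: "(int \<times> int) set" where
  "tri_ladder_verts = {(a, b). b \<in> {0, 1} \<and> even (a + b)}"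

definition tri_ladder_adj :: "int \<times> int \<Rightarrow> int \<times> int \<Rightarrow> bool" where
  "tri_ladder_adj = (\<lambda>(x1, y1) (x2, y2).
     (\<bar>x1 - x2\<bar> = 1 \<and> \<bar>y1 - y2\<bar> = 1) \<or> (y1 = y2 \<and> \<bar>x1 - x2\<bar> = 2))"

end

theory Submission
  imports Defs
begin

text \<open>
  Sending \<open>a\<close> to the vertex \<open>(a, a mod 2)\<close> identifies the ladder with the integers,
  two of them being adjacent iff they differ by 1 or 2.  A walk on the integers with such steps
  moves outward, and the only memory it needs is the pattern left behind it: a leap over a site
  leaves that site as a gap, and a run of leaps leaves a comb of \<open>k\<close> gaps that alternate
  with visited sites.  A walk that steps back into the comb can only fall from gap to gap.  At the far
  end it is either trapped, or, if the comb reaches back to the starting vertex, it comes out on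
  the other side of everything visited and starts again as an outward walk in the opposite direction.
  So the walk is described by a Markov chain on \<open>state\<close>: the kind of position it has at the
  comb, the number of gaps and the nature of the far end (\<open>walk_state_succ\<close>).

  The probability of exactly \<open>n\<close> remaining steps is determined by recursion on \<open>n\<close>,
  by one unfolding of the definition of the walk at a time, so it agrees with the exit law of the
  chain (\<open>spmf_remaining_steps\<close>).  Termination with probability 1 then amounts to the exit
  probabilities summing to 1, and it is obtained together with the moments as the case of the
  zeroth one.

  The mean and the second moment of the exit time satisfy linear equations over the chain.  For long
  combs they are polynomials in the number of gaps, and the equations at the few exceptional states
  fix the constants; the solutions are written down explicitly and checked.  That these solutions of
  the equations are indeed the moments is a uniqueness statement (\<open>exit_prob_sums\<close>): a positive
  weight on the states shrinks on average by a constant factor above 1 per step, whence the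
  contribution of the walks that survive \<open>n\<close> steps vanishes as \<open>n\<close> grows.
\<close>

section \<open>Exit times of finitely branching chains\<close>

definition mean_list :: "('s \<Rightarrow> real) \<Rightarrow> 's list \<Rightarrow> real" where
  "mean_list f xs = sum_list (map f xs) / real (length xs)"

lemma mean_list_simps [simp]:
  "mean_list f [] = 0"
  "mean_list f [x] = f x"
  "mean_list f [x, y] = (f x + f y) / 2"
  "mean_list f [x, y, z] = (f x + f y + f z) / 3"
  "mean_list f [x, y, z, u] = (f x + f y + f z + f u) / 4"
  by (simp_all add: mean_list_def)

lemma mean_list_mult_left: "mean_list (\<lambda>t. c * f t) xs = c * mean_list f xs"
  by (simp add: mean_list_def sum_list_const_mult)

lemma mean_list_const: "xs \<noteq> [] \<Longrightarrow> mean_list (\<lambda>t. c) xs = c"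
  by (simp add: mean_list_def sum_list_const_mult sum_list_replicate map_replicate_const)

lemma mean_list_add: "mean_list (\<lambda>t. f t + g t) xs = mean_list f xs + mean_list g xs"
  by (simp add: mean_list_def sum_list_addf add_divide_distrib)

lemma mean_list_diff: "mean_list (\<lambda>t. f t - g t) xs = mean_list f xs - mean_list g xs"
  by (simp add: mean_list_def sum_list_subtractf diff_divide_distrib)

lemma mean_list_mono: "(\<And>t. t \<in> set xs \<Longrightarrow> f t \<le> g t) \<Longrightarrow> mean_list f xs \<le> mean_list g xs"
  by (simp add: mean_list_def sum_list_mono divide_right_mono)

lemma mean_list_abs: "\<bar>mean_list f xs\<bar> \<le> mean_list (\<lambda>t. \<bar>f t\<bar>) xs"
  by (simp add: mean_list_def abs_divide divide_right_mono)
    (use sum_list_abs[of "map f xs"] in \<open>simp add: divide_right_mono comp_def\<close>)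

lemma mean_list_sum: "mean_list (\<lambda>t. \<Sum>i\<in>I. f i t) xs = (\<Sum>i\<in>I. mean_list (f i) xs)"
proof -
  have "(\<Sum>t\<leftarrow>xs. \<Sum>i\<in>I. f i t) = (\<Sum>i\<in>I. \<Sum>t\<leftarrow>xs. f i t)"
    by (induction xs) (simp_all add: sum.distrib)
  then show ?thesis by (simp add: mean_list_def sum_divide_distrib)
qed

text \<open>
  The chain moves from \<open>s\<close> to a uniformly chosen entry of \<open>succ s\<close> and exits where this list
  is empty; a repeated entry counts with its multiplicity.  As the mean over the empty list is 0,
  exit at an exit state happens at time 0 only.
\<close>

primrec exit_prob :: "('s \<Rightarrow> 's list) \<Rightarrow> nat \<Rightarrow> 's \<Rightarrow> real" where
  "exit_prob succ 0 s = (if succ s = [] then 1 else 0)"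
| "exit_prob succ (Suc n) s = mean_list (exit_prob succ n) (succ s)"

text \<open>
  Let \<open>H s a\<close> be the candidate for the expectation of \<open>f\<close> at the exit time when the chain is in
  \<open>s\<close> at time \<open>a\<close>.  The recursion for \<open>H\<close> alone has many solutions.  Unrolling it \<open>n\<close>
  times shows that \<open>H\<close> differs from the \<open>n\<close>-th partial sum by the integral of \<open>H\<close> over the chains
  still alive at time \<open>a + n\<close>.  Under the bound this is at most \<open>K * \<mu> ^ (a + n)\<close> times the
  integral of \<open>W\<close> over those chains, and by the drift condition each step divides that integral by
  \<open>\<rho>\<close>.
\<close>

lemma exit_prob_sums:
  fixes f :: "nat \<Rightarrow> real" and H :: "'s \<Rightarrow> nat \<Rightarrow> real" and W :: "'s \<Rightarrow> real"
  assumes exit: "\<And>s a. succ s = [] \<Longrightarrow> H s a = f a"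
    and step: "\<And>s a. succ s \<noteq> [] \<Longrightarrow> H s a = mean_list (\<lambda>t. H t (Suc a)) (succ s)"
    and drift: "\<And>s. succ s \<noteq> [] \<Longrightarrow> \<rho> * mean_list W (succ s) \<le> W s"
    and bound: "\<And>s a. \<bar>H s a\<bar> \<le> K * \<mu> ^ a * W s"
    and rates: "0 \<le> K" "0 < \<mu>" "\<mu> < \<rho>"
  shows "(\<lambda>i. f (a + i) * exit_prob succ i s) sums H s a"
proof -
  have nonneg: "0 \<le> K * \<mu> ^ a * W s" for s a
    using bound[of s a] by linarith
  have err: "\<bar>H s a - (\<Sum>i<n. f (a + i) * exit_prob succ i s)\<bar> \<le> K * \<mu> ^ a * W s * (\<mu> / \<rho>) ^ n"
    for n s a
  proof (induction n arbitrary: s a)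
    case 0
    then show ?case using bound by simp
  next
    case (Suc n)
    show ?case
    proof (cases "succ s = []")
      case True
      then have "(\<Sum>i<Suc n. f (a + i) * exit_prob succ i s) = H s a"
        by (simp add: sum.lessThan_Suc_shift exit del: sum.lessThan_Suc)
      then show ?thesis using nonneg[of a s] rates by simp
    next
      case False
      have "(\<Sum>i<Suc n. f (a + i) * exit_prob succ i s)
          = (\<Sum>i<n. f (Suc a + i) * mean_list (exit_prob succ i) (succ s))"
        using False by (simp add: sum.lessThan_Suc_shift del: sum.lessThan_Suc)
      also have "\<dots> = mean_list (\<lambda>t. \<Sum>i<n. f (Suc a + i) * exit_prob succ i t) (succ s)"
        by (simp add: mean_list_sum mean_list_mult_left)
      finally have "\<bar>H s a - (\<Sum>i<Suc n. f (a + i) * exit_prob succ i s)\<bar>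
          \<le> mean_list (\<lambda>t. \<bar>H t (Suc a) - (\<Sum>i<n. f (Suc a + i) * exit_prob succ i t)\<bar>) (succ s)"
        using mean_list_abs by (simp only: step[OF False] mean_list_diff[symmetric])
      also have "\<dots> \<le> mean_list (\<lambda>t. (K * \<mu> ^ Suc a * (\<mu> / \<rho>) ^ n) * W t) (succ s)"
        using Suc.IH[of _ "Suc a"] by (intro mean_list_mono) (simp add: mult_ac)
      also have "\<dots> = (K * \<mu> ^ a * (\<mu> / \<rho>) ^ Suc n) * (\<rho> * mean_list W (succ s))"
        using rates by (simp add: mean_list_mult_left)
      also have "\<dots> \<le> (K * \<mu> ^ a * (\<mu> / \<rho>) ^ Suc n) * W s"
        using rates drift[OF False] by (intro mult_left_mono) auto
      finally show ?thesis by (simp add: mult_ac)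
    qed
  qed
  have "(\<lambda>n. K * \<mu> ^ a * W s * (\<mu> / \<rho>) ^ n) \<longlonglongrightarrow> 0"
    using rates by (intro tendsto_mult_right_zero LIMSEQ_power_zero) simp
  then have "(\<lambda>n. H s a - (\<Sum>i<n. f (a + i) * exit_prob succ i s)) \<longlonglongrightarrow> 0"
    by (rule Lim_null_comparison[rotated]) (use err in simp)
  from tendsto_diff[OF tendsto_const[of "H s a"] this]
  have "(\<lambda>n. \<Sum>i<n. f (a + i) * exit_prob succ i s) \<longlonglongrightarrow> H s a"
    by simp
  then show ?thesis by (simp add: sums_def)
qed

section \<open>The length of a growing self-avoiding walk through a lumped chain\<close>

lemma gsaw_from_length:
  assumes "r \<in> set_spmf (gsaw_from V adj p)"
  shows "length p \<le> length r"
proof -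
  have "\<forall>p. \<forall>r\<in>set_spmf (gsaw_from V adj p). length p \<le> length r"
  proof (induction rule: gsaw_from.fixp_induct)
    case 1 show ?case by simp
  next
    case 2 show ?case by simp
  next
    case (3 g)
    then show ?case by (fastforce simp: set_bind_spmf split: if_splits)
  qed
  then show ?thesis using assms by blast
qed

text \<open>
  The time parameter has to be measured from \<open>p\<close> on, so that lumped walks of different lengths can
  have the same law.
\<close>

definition remaining_steps :: "'a set \<Rightarrow> ('a \<Rightarrow> 'a \<Rightarrow> bool) \<Rightarrow> 'a list \<Rightarrow> nat spmf" where
  "remaining_steps V adj p = map_spmf (\<lambda>r. length r - length p) (gsaw_from V adj p)"

lemma remaining_steps_trapped:
  "unvisited_neighbors V adj p = {} \<Longrightarrow> remaining_steps V adj p = return_spmf 0"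
  by (simp add: remaining_steps_def gsaw_from.simps)

lemma remaining_steps_step:
  assumes "unvisited_neighbors V adj p \<noteq> {}"
  shows "remaining_steps V adj p = bind_spmf (spmf_of_set (unvisited_neighbors V adj p))
    (\<lambda>w. map_spmf Suc (remaining_steps V adj (w # p)))"
proof -
  have "map_spmf (\<lambda>r. length r - length p) (gsaw_from V adj (w # p))
      = map_spmf Suc (remaining_steps V adj (w # p))" for w
    unfolding remaining_steps_def spmf.map_comp
    by (rule map_spmf_cong) (use gsaw_from_length in \<open>fastforce simp: Suc_diff_le\<close>)+
  then show ?thesis
    using assms by (simp add: remaining_steps_def gsaw_from.simps[of V adj p] map_spmf_bind_spmf o_def)
qed

text \<open>
  If \<open>R\<close> matches the extensions of a walk one to one with the successors of its state, then the
  remaining length of the walk has the exit law of the chain.  The induction is on the number of steps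
  and unfolds the definition of the walk once per step.
\<close>

lemma spmf_remaining_steps:
  assumes lump: "\<And>p s. R p s \<Longrightarrow> \<exists>ws. distinct ws \<and> set ws = unvisited_neighbors V adj p
      \<and> list_all2 (\<lambda>w t. R (w # p) t) ws (succ s)"
    and "R p s"
  shows "spmf (remaining_steps V adj p) n = exit_prob succ n s"
  using \<open>R p s\<close>
proof (induction n arbitrary: p s)
  case 0
  obtain ws where ws: "distinct ws" "set ws = unvisited_neighbors V adj p"
    "list_all2 (\<lambda>w t. R (w # p) t) ws (succ s)" using lump[OF 0] by blast
  have "unvisited_neighbors V adj p = {} \<longleftrightarrow> succ s = []"
    using ws(3) by (auto simp flip: ws(2))
  then show ?case
    by (auto simp: remaining_steps_trapped remaining_steps_step spmf_bind spmf_map_outside)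
next
  case (Suc n)
  obtain ws where ws: "distinct ws" "set ws = unvisited_neighbors V adj p"
    "list_all2 (\<lambda>w t. R (w # p) t) ws (succ s)" using lump[OF Suc.prems] by blast
  show ?case
  proof (cases "succ s = []")
    case True
    then show ?thesis using ws by (simp add: remaining_steps_trapped)
  next
    case False
    then have "unvisited_neighbors V adj p \<noteq> {}" using ws(3) by (auto simp flip: ws(2))
    then have "spmf (remaining_steps V adj p) (Suc n)
        = (\<Sum>w\<in>set ws. spmf (remaining_steps V adj (w # p)) n) / real (card (set ws))"
      by (simp add: ws(2) remaining_steps_step spmf_bind integral_spmf_of_set spmf_map_inj')
    also have "\<dots> = mean_list (\<lambda>w. spmf (remaining_steps V adj (w # p)) n) ws"
      using ws(1) by (simp add: mean_list_def sum_list_distinct_conv_sum_set distinct_card)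
    also have "map (\<lambda>w. spmf (remaining_steps V adj (w # p)) n) ws = map (exit_prob succ n) (succ s)"
      using ws(3) by (induction rule: list_all2_induct) (simp_all add: Suc.IH)
    then have "mean_list (\<lambda>w. spmf (remaining_steps V adj (w # p)) n) ws = mean_list (exit_prob succ n) (succ s)"
      using list_all2_lengthD[OF ws(3)] by (simp add: mean_list_def)
    finally show ?thesis by simp
  qed
qed

section \<open>The chain of the triangular ladder\<close>

text \<open>
  What lies beyond the last gap of a comb: a visited site, or the untouched half-line on the other
  side of the starting vertex.
\<close>

datatype far_end = Walled | Free

text \<open>
  Except for \<open>Start\<close>, a state is read in coordinates in which the walk stands at 0 and has its comb on the negative
  side; the number is that of the gaps, except that \<open>Leap e k\<close> has \<open>k + 1\<close> of them.
  After a leap outward the site behind the walk is itself the first gap (\<open>Leap\<close>), after an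
  outward step of length 1 it is not (\<open>Advance\<close>).  In \<open>Turn\<close> the walk has stepped back into
  the first gap and can still jump out over its previous position, in \<open>Retreat\<close> it is deeper
  inside and can no longer do so.
\<close>

datatype state =
    Start
  | Advance far_end nat
  | Leap far_end nat
  | Turn far_end nat
  | Retreat far_end nat

text \<open>
  The moves into the next gap.  With no gap left, a walled comb offers none, while a free one lets
  the walk out.  There it faces the untouched half-line and has two visited sites behind
  it, which is \<open>Advance Walled 0\<close> in the mirrored coordinates.
\<close>

fun enter_comb :: "far_end \<Rightarrow> nat \<Rightarrow> state list" where
  "enter_comb e (Suc k) = [Retreat e k]"
| "enter_comb Free 0 = [Advance Walled 0]"
| "enter_comb Walled 0 = []"

fun succ :: "state \<Rightarrow> state list" where
  "succ Start = [Advance Free 0, Advance Free 0, Leap Free 0, Leap Free 0]"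
| "succ (Advance e k) = enter_comb e k @ [Advance Walled 0, Leap Walled 0]"
| "succ (Leap e k) = [Turn e k, Advance e (Suc k), Leap e (Suc k)]"
| "succ (Turn e k) = enter_comb e k @ [Advance Walled 0]"
| "succ (Retreat e k) = enter_comb e k"

text \<open>
  \<open>U\<close> is the set of visited sites; the comb is read downwards from \<open>x\<close>.
\<close>

fun comb :: "(int \<Rightarrow> bool) \<Rightarrow> int \<Rightarrow> far_end \<Rightarrow> nat \<Rightarrow> bool" where
  "comb U x e (Suc k) \<longleftrightarrow> \<not> U x \<and> U (x - 1) \<and> comb U (x - 2) e k"
| "comb U x Walled 0 \<longleftrightarrow> U x"
| "comb U x Free 0 \<longleftrightarrow> (\<forall>i\<le>x. \<not> U i)"

fun shape :: "(int \<Rightarrow> bool) \<Rightarrow> state \<Rightarrow> bool" where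
  "shape U Start \<longleftrightarrow> (\<forall>i. U i \<longleftrightarrow> i = 0)"
| "shape U (Advance e k) \<longleftrightarrow> U 0 \<and> U (-1) \<and> comb U (-2) e k \<and> (\<forall>i>0. \<not> U i)"
| "shape U (Leap e k) \<longleftrightarrow> U 0 \<and> comb U (-1) e (Suc k) \<and> (\<forall>i>0. \<not> U i)"
| "shape U (Turn e k) \<longleftrightarrow> U 0 \<and> U (-1) \<and> comb U (-2) e k \<and> U 1 \<and> (\<forall>i>1. \<not> U i)"
| "shape U (Retreat e k) \<longleftrightarrow> U 0 \<and> U (-1) \<and> comb U (-2) e k \<and> U 1 \<and> U 2"

text \<open>
  The visited sites after a move to the site \<open>d\<close>, seen from there, with \<open>\<tau> = -1\<close> for
  the coordinates mirrored.
\<close>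

definition moved :: "(int \<Rightarrow> bool) \<Rightarrow> int \<Rightarrow> int \<Rightarrow> int \<Rightarrow> bool" where
  "moved U d \<tau> = (\<lambda>i. i = 0 \<or> U (d + \<tau> * i))"

lemma comb_moved: "x < 0 \<Longrightarrow> comb (moved U d 1) x e k \<longleftrightarrow> comb U (d + x) e k"
proof (induction "moved U d 1" x e k rule: comb.induct)
  case (3 x)
  have "(\<forall>i\<le>x. \<not> moved U d 1 i) \<longleftrightarrow> (\<forall>i\<le>x. \<not> U (d + i))"
    using 3 by (auto simp: moved_def)
  also have "\<dots> \<longleftrightarrow> (\<forall>i\<le>d + x. \<not> U i)"
  proof safe
    fix i assume "\<forall>i\<le>x. \<not> U (d + i)" "i \<le> d + x" "U i"
    then show False by (auto dest: spec[of _ "i - d"])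
  qed simp
  finally show ?case by simp
qed (auto simp: moved_def algebra_simps)

definition reaches :: "(int \<Rightarrow> bool) \<Rightarrow> int \<Rightarrow> state \<Rightarrow> bool" where
  "reaches U d s \<longleftrightarrow> (\<exists>\<tau>\<in>{1, -1}. shape (moved U d \<tau>) s)"

lemma reaches_forward: "shape (moved U d 1) s \<Longrightarrow> reaches U d s"
  by (auto simp: reaches_def)

lemma enter_comb_moves:
  assumes "U 0" "U (-1)" "comb U (-2) e k"
  obtains ds where "set ds = {-2} \<inter> {d. \<not> U d}" "distinct ds"
    "list_all2 (reaches U) ds (enter_comb e k)"
proof (cases k)
  case (Suc j)
  have "shape (moved U (-2) 1) (Retreat e j)"
    using assms Suc by (simp add: comb_moved) (simp add: moved_def)
  then show ?thesis
    using assms Suc by (intro that[of "[-2]"]) (auto intro: reaches_forward)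
next
  case 0
  show ?thesis
  proof (cases e)
    case Walled
    then show ?thesis using assms 0 by (intro that[of "[]"]) auto
  next
    case Free
    have "shape (moved U (-2) (-1)) (Advance Walled 0)"
      using assms 0 Free by (auto simp: moved_def)
    then show ?thesis
      using assms 0 Free by (intro that[of "[-2]"]) (auto simp: reaches_def)
  qed
qed

text \<open>
  This is the whole geometry of the ladder: near the walk the visited sites are known exactly, and
  the four possible moves are checked state by state.  Only the start and the exit from a free comb
  need the mirrored coordinates.
\<close>

lemma shape_moves:
  assumes "shape U s"
  shows "\<exists>ds. distinct ds \<and> set ds = {-2, -1, 1, 2} \<inter> {d. \<not> U d} \<and> list_all2 (reaches U) ds (succ s)"
proof (cases s)
  case Start
  have U: "U i \<longleftrightarrow> i = 0" for i using assms Start by simp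
  have "shape (moved U 1 1) (Advance Free 0)" "shape (moved U (-1) (-1)) (Advance Free 0)"
    "shape (moved U 2 1) (Leap Free 0)" "shape (moved U (-2) (-1)) (Leap Free 0)"
    by (auto simp: moved_def U)
  then show ?thesis
    using Start by (intro exI[of _ "[1, -1, 2, -2]"]) (auto simp: U reaches_def)
next
  case (Advance e k)
  then have U: "U 0" "U (-1)" "comb U (-2) e k" "\<And>i. i > 0 \<Longrightarrow> \<not> U i" using assms by auto
  obtain ds where ds: "set ds = {-2} \<inter> {d. \<not> U d}" "distinct ds" "list_all2 (reaches U) ds (enter_comb e k)"
    using enter_comb_moves U(1-3) .
  have "shape (moved U 1 1) (Advance Walled 0)" "shape (moved U 2 1) (Leap Walled 0)"
    using U by (auto simp: moved_def)
  then show ?thesis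
    using Advance ds U
    by (intro exI[of _ "ds @ [1, 2]"]) (auto intro!: list_all2_appendI intro: reaches_forward)
next
  case (Leap e k)
  then have U: "U 0" "\<not> U (-1)" "U (-2)" "comb U (-3) e k" "\<And>i. i > 0 \<Longrightarrow> \<not> U i" using assms by auto
  have "shape (moved U (-1) 1) (Turn e k)" "shape (moved U 1 1) (Advance e (Suc k))"
    "shape (moved U 2 1) (Leap e (Suc k))"
    using U by (simp_all add: comb_moved) (auto simp: moved_def)
  then show ?thesis
    using Leap U by (intro exI[of _ "[-1, 1, 2]"]) (auto intro: reaches_forward)
next
  case (Turn e k)
  then have U: "U 0" "U (-1)" "comb U (-2) e k" "U 1" "\<And>i. i > 1 \<Longrightarrow> \<not> U i" using assms by auto
  obtain ds where ds: "set ds = {-2} \<inter> {d. \<not> U d}" "distinct ds" "list_all2 (reaches U) ds (enter_comb e k)"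
    using enter_comb_moves U(1-3) .
  have "shape (moved U 2 1) (Advance Walled 0)"
    using U by (auto simp: moved_def)
  then show ?thesis
    using Turn ds U
    by (intro exI[of _ "ds @ [2]"]) (auto intro!: list_all2_appendI intro: reaches_forward)
next
  case (Retreat e k)
  then have U: "U 0" "U (-1)" "comb U (-2) e k" "U 1" "U 2" using assms by auto
  obtain ds where ds: "set ds = {-2} \<inter> {d. \<not> U d}" "distinct ds" "list_all2 (reaches U) ds (enter_comb e k)"
    using enter_comb_moves U(1-3) .
  then show ?thesis using Retreat U by (intro exI[of _ ds]) auto
qed

definition vert :: "int \<Rightarrow> int \<times> int" where
  "vert a = (a, a mod 2)"

lemma vert_inject [simp]: "vert a = vert b \<longleftrightarrow> a = b"
  by (auto simp: vert_def)

lemma tri_ladder_verts_eq: "tri_ladder_verts = range vert"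
proof -
  have "(a, b) \<in> tri_ladder_verts \<longleftrightarrow> b = a mod 2" for a b :: int
    unfolding tri_ladder_verts_def by auto presburger+
  then show ?thesis by (auto simp: vert_def)
qed

lemma tri_ladder_adj_vert: "tri_ladder_adj (vert a) (vert b) \<longleftrightarrow> b - a \<in> {-2, -1, 1, 2}"
  unfolding tri_ladder_adj_def vert_def by simp presburger

definition walk_state :: "(int \<times> int) list \<Rightarrow> state \<Rightarrow> bool" where
  "walk_state p s \<longleftrightarrow> p \<noteq> [] \<and> (\<exists>x. \<exists>\<tau>\<in>{1, -1}. hd p = vert x \<and> shape (\<lambda>i. vert (x + \<tau> * i) \<in> set p) s)"

lemma walk_state_succ:
  assumes "walk_state p s"
  shows "\<exists>ws. distinct ws \<and> set ws = unvisited_neighbors tri_ladder_verts tri_ladder_adj p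
    \<and> list_all2 (\<lambda>w t. walk_state (w # p) t) ws (succ s)"
proof -
  obtain x \<tau> where x: "hd p = vert x" "\<tau> \<in> {1, -1}" "shape (\<lambda>i. vert (x + \<tau> * i) \<in> set p) s"
    using assms unfolding walk_state_def by blast
  let ?U = "\<lambda>i. vert (x + \<tau> * i) \<in> set p"
  let ?w = "\<lambda>d. vert (x + \<tau> * d)"
  obtain ds where ds: "distinct ds" "set ds = {-2, -1, 1, 2} \<inter> {d. \<not> ?U d}"
    "list_all2 (reaches ?U) ds (succ s)" using shape_moves[OF x(3)] by blast
  have "walk_state (?w d # p) t" if "reaches ?U d t" for d t
  proof -
    obtain \<sigma> where \<sigma>: "\<sigma> \<in> {1, -1}" "shape (moved ?U d \<sigma>) t" using \<open>reaches ?U d t\<close> by (auto simp: reaches_def)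
    have "moved ?U d \<sigma> = (\<lambda>i. vert (x + \<tau> * d + \<tau> * \<sigma> * i) \<in> set (?w d # p))"
      using x(2) \<sigma>(1) by (auto simp: moved_def fun_eq_iff algebra_simps)
    then show ?thesis
      using \<sigma> x(2) unfolding walk_state_def
      by (intro conjI exI[of _ "x + \<tau> * d"] bexI[of _ "\<tau> * \<sigma>"]) auto
  qed
  then have "list_all2 (\<lambda>w t. walk_state (w # p) t) (map ?w ds) (succ s)"
    using ds(3) by (auto simp: list_all2_map1 elim: list_all2_mono)
  moreover have "distinct (map ?w ds)"
    using ds(1) x(2) by (auto simp: distinct_map inj_on_def)
  moreover have "set (map ?w ds) = unvisited_neighbors tri_ladder_verts tri_ladder_adj p"
  proof -
    have "vert b \<in> ?w ` set ds \<longleftrightarrow> vert b \<in> unvisited_neighbors tri_ladder_verts tri_ladder_adj p" for b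
    proof -
      have "vert b \<in> ?w ` set ds \<longleftrightarrow> \<tau> * (b - x) \<in> set ds"
        using x(2) by (auto simp: image_iff intro: bexI[of _ "b - x"] bexI[of _ "x - b"])
      also have "\<dots> \<longleftrightarrow> \<tau> * (b - x) \<in> {-2, -1, 1, 2} \<and> vert (x + \<tau> * (\<tau> * (b - x))) \<notin> set p"
        unfolding ds(2) by simp
      also have "x + \<tau> * (\<tau> * (b - x)) = b"
        using x(2) by auto
      also have "\<tau> * (b - x) \<in> {-2, -1, 1, 2} \<longleftrightarrow> b - x \<in> {-2, -1, 1, 2}"
        using x(2) by auto
      finally show ?thesis
        by (simp add: unvisited_neighbors_def tri_ladder_verts_eq x(1) tri_ladder_adj_vert del: insert_iff)
    qed
    moreover have "unvisited_neighbors tri_ladder_verts tri_ladder_adj p \<subseteq> range vert"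
      by (auto simp: unvisited_neighbors_def tri_ladder_verts_eq)
    moreover have "?w ` set ds \<subseteq> range vert"
      by blast
    ultimately show ?thesis
      unfolding set_map by blast
  qed
  ultimately show ?thesis by blast
qed

section \<open>Moments of the exit time\<close>

text \<open>
  Let \<open>d\<close> and \<open>c\<close> be the expected exit times from \<open>Advance Walled 0\<close> and
  \<open>Leap Walled 0\<close>.  All states but the start and the leaps are expressed by \<open>d\<close> and \<open>c\<close> at once.  The value
  \<open>x k\<close> of a leap with many comb_index satisfies \<open>x k = x (k + 1) / 3\<close> plus a linear term in
  \<open>k\<close>, whose solutions without exponential growth are linear; its slope is \<open>5 / 12\<close>.  The
  equations at the two special states then give \<open>d = 103 / 6\<close> and \<open>c = 91 / 6\<close>.
\<close>

fun exit_mean :: "state \<Rightarrow> real" where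
  "exit_mean Start = 941 / 48"
| "exit_mean (Retreat Walled k) = k"
| "exit_mean (Retreat Free k) = k + 1 + 103 / 6"
| "exit_mean (Turn Walled 0) = 1 + 103 / 6"
| "exit_mean (Turn Walled (Suc k)) = 1 + (k + 103 / 6) / 2"
| "exit_mean (Turn Free k) = 1 + (k + 103 / 6 + 103 / 6) / 2"
| "exit_mean (Advance Walled 0) = 103 / 6"
| "exit_mean (Advance Walled (Suc k)) = 1 + (k + 103 / 6 + 91 / 6) / 3"
| "exit_mean (Advance Free k) = 1 + (k + 103 / 6 + 103 / 6 + 91 / 6) / 3"
| "exit_mean (Leap Walled 0) = 91 / 6"
| "exit_mean (Leap Walled (Suc k)) = 5 / 12 * (k + 1) + 437 / 36"
| "exit_mean (Leap Free k) = 5 / 12 * k + 473 / 24"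

text \<open>
  The same scheme, with the second moments \<open>8909 / 18\<close> and \<open>7709 / 18\<close> in place of
  \<open>d\<close> and \<open>c\<close>.  A delay of \<open>m\<close> steps before \<open>Advance Walled 0\<close> turns its second moment into
  \<open>m\<^sup>2 + 103 / 3 * m + 8909 / 18\<close>, and similarly with \<open>91 / 3\<close> and \<open>7709 / 18\<close> for
  \<open>Leap Walled 0\<close>.
\<close>

fun exit_second_moment :: "state \<Rightarrow> real" where
  "exit_second_moment Start = 84547 / 144"
| "exit_second_moment (Retreat Walled k) = k\<^sup>2"
| "exit_second_moment (Retreat Free k) = (k + 1)\<^sup>2 + 103 / 3 * (k + 1) + 8909 / 18"
| "exit_second_moment (Turn Walled 0) = 1 + 103 / 3 + 8909 / 18"
| "exit_second_moment (Turn Walled (Suc k)) = ((k + 1)\<^sup>2 + (1 + 103 / 3 + 8909 / 18)) / 2"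
| "exit_second_moment (Turn Free k)
    = ((k + 1)\<^sup>2 + 103 / 3 * (k + 1) + 8909 / 18 + (1 + 103 / 3 + 8909 / 18)) / 2"
| "exit_second_moment (Advance Walled 0) = 8909 / 18"
| "exit_second_moment (Advance Walled (Suc k))
    = ((k + 1)\<^sup>2 + (1 + 103 / 3 + 8909 / 18) + (1 + 91 / 3 + 7709 / 18)) / 3"
| "exit_second_moment (Advance Free k)
    = ((k + 1)\<^sup>2 + 103 / 3 * (k + 1) + 8909 / 18
       + (1 + 103 / 3 + 8909 / 18) + (1 + 91 / 3 + 7709 / 18)) / 3"
| "exit_second_moment (Leap Walled 0) = 7709 / 18"
| "exit_second_moment (Leap Walled (Suc k)) = 5 / 12 * (k + 1)\<^sup>2 + 2 * (k + 1) + 36055 / 108"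
| "exit_second_moment (Leap Free k) = 5 / 12 * k\<^sup>2 + 617 / 36 * k + 4729 / 8"

text \<open>
  The rate \<open>51 / 50\<close> has to be above 1 and so small that the corresponding exponential moment of
  the exit time is finite.  It is kept behind a constant because the simplifier would otherwise evaluate,
  and thereby lose, the fact that its powers are at least 1.
\<close>

definition growth :: "nat \<Rightarrow> real" where
  "growth k = (51 / 50) ^ k"

lemma growth_simps [simp]: "growth 0 = 1" "growth (Suc k) = 51 / 50 * growth k"
  by (simp_all add: growth_def)

lemma growth_ge_1: "1 \<le> growth k"
  by (simp add: growth_def)

text \<open>
  For \<open>r > 1\<close> and the exit time \<open>T\<close>, the mean of \<open>r ^ T\<close> as a function of the state
  shrinks by the factor \<open>r\<close> per step.  The values \<open>2\<close> and \<open>19 / 10\<close> and the two formulas for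
  longer leaps approximate this function, by simple fractions, for an \<open>r\<close> slightly above
  \<open>51 / 50\<close>; the excess leaves room for the rounding.  The other values follow from these by the
  recursion with rate \<open>51 / 50\<close>, except that the one at \<open>Start\<close> is rounded up.
\<close>

fun decay_weight :: "state \<Rightarrow> real" where
  "decay_weight Start = 11 / 5"
| "decay_weight (Retreat Walled k) = growth k"
| "decay_weight (Retreat Free k) = 2 * growth (Suc k)"
| "decay_weight (Turn Walled 0) = 51 / 25"
| "decay_weight (Turn Walled (Suc k)) = 51 / 100 * (growth k + 2)"
| "decay_weight (Turn Free k) = 51 / 100 * (2 * growth k + 2)"
| "decay_weight (Advance Walled 0) = 2"
| "decay_weight (Advance Walled (Suc k)) = 17 / 50 * (growth k + 2 + 19 / 10)"
| "decay_weight (Advance Free k) = 17 / 50 * (2 * growth k + 2 + 19 / 10)"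
| "decay_weight (Leap Walled 0) = 19 / 10"
| "decay_weight (Leap Walled (Suc k)) = 5 / 4 + growth (Suc k) / 2"
| "decay_weight (Leap Free k) = 5 / 4 + growth k"

fun comb_index :: "state \<Rightarrow> nat" where
  "comb_index Start = 0"
| "comb_index (Advance e k) = k"
| "comb_index (Leap e k) = k"
| "comb_index (Turn e k) = k"
| "comb_index (Retreat e k) = k"

lemma state_cases:
  assumes "P Start"
    "P (Retreat Walled 0)" "\<And>k. P (Retreat Walled (Suc k))" "P (Retreat Free 0)" "\<And>k. P (Retreat Free (Suc k))"
    "P (Turn Walled 0)" "\<And>k. P (Turn Walled (Suc k))" "P (Turn Free 0)" "\<And>k. P (Turn Free (Suc k))"
    "P (Advance Walled 0)" "\<And>k. P (Advance Walled (Suc k))" "P (Advance Free 0)" "\<And>k. P (Advance Free (Suc k))"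
    "P (Leap Walled 0)" "\<And>k. P (Leap Walled (Suc k))" "P (Leap Free 0)" "\<And>k. P (Leap Free (Suc k))"
  shows "P s"
proof (cases s)
  case Start
  then show ?thesis using assms(1) by simp
next
  case (Retreat e k)
  then show ?thesis using assms(2-5) by (cases e; cases k) simp_all
next
  case (Turn e k)
  then show ?thesis using assms(6-9) by (cases e; cases k) simp_all
next
  case (Advance e k)
  then show ?thesis using assms(10-13) by (cases e; cases k) simp_all
next
  case (Leap e k)
  then show ?thesis using assms(14-17) by (cases e; cases k) simp_all
qed

lemma exit_mean_step:
  "succ s \<noteq> [] \<Longrightarrow> exit_mean s = mean_list (\<lambda>t. 1 + exit_mean t) (succ s)"
  by (rule state_cases[of _ s]) (simp_all add: algebra_simps add_divide_distrib)

lemma exit_second_moment_step: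
  "succ s \<noteq> [] \<Longrightarrow>
    exit_second_moment s = mean_list (\<lambda>t. 1 + 2 * exit_mean t + exit_second_moment t) (succ s)"
  by (rule state_cases[of _ s]) (simp_all add: algebra_simps add_divide_distrib power2_eq_square)

text \<open>
  For an index \<open>Suc k\<close> both sides are affine in \<open>growth k\<close>, and \<open>1 \<le> growth k\<close> absorbs the
  constants; hence the index shifted by 1 in the proofs.
\<close>

lemma decay_weight_step:
  assumes "succ s \<noteq> []"
  shows "51 / 50 * mean_list decay_weight (succ s) \<le> decay_weight s"
  using growth_ge_1[of "comb_index s - 1"] assms
  by (induction s rule: state_cases) (simp_all add: algebra_simps add_divide_distrib)

lemma decay_weight_lower: "growth (comb_index s) \<le> 3 * decay_weight s"
  using growth_ge_1[of "comb_index s - 1"]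
  by (induction s rule: state_cases) (simp_all add: algebra_simps)

lemma exit_mean_bound: "0 \<le> exit_mean s \<and> exit_mean s \<le> comb_index s + 30"
  by (rule state_cases[of _ s]) (simp_all add: algebra_simps add_divide_distrib)

lemma exit_second_moment_bound: "0 \<le> exit_second_moment s \<and> exit_second_moment s \<le> (comb_index s + 30)\<^sup>2"
  apply (rule state_cases[of _ s])
                  apply (simp_all add: algebra_simps add_divide_distrib power2_eq_square)
       subgoal for k using zero_le_square[of "real k"] by linarith
      subgoal for k using zero_le_square[of "real k"] by linarith
     subgoal for k using zero_le_square[of "real k"] by linarith
    subgoal for k using zero_le_square[of "real k"] by linarith
   subgoal for k using zero_le_square[of "real k"] by linarith
  subgoal for k using zero_le_square[of "real k"] by linarith
  done

text \<open>
  Both moments grow polynomially in the number of gaps, and up to a constant factor a polynomial is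
  dominated by an exponential of any rate above 1.  By Bernoulli's inequality \<open>n + 200\<close> is at most \<open>200 * (201 / 200) ^ n\<close>;
  the squared rate \<open>40401 / 40000\<close> is still below the drift rate \<open>51 / 50\<close>.
\<close>

lemma moment_bound: "(real a + comb_index s + 30)\<^sup>2 \<le> 120000 * (40401 / 40000) ^ a * decay_weight s"
proof -
  let ?n = "a + comb_index s"
  have "real a + comb_index s + 30 \<le> 200 * (1 + real ?n * (1 / 200))" by (simp add: field_simps)
  also have "\<dots> \<le> 200 * (1 + 1 / 200) ^ ?n"
    by (intro mult_left_mono Bernoulli_inequality) simp_all
  finally have "(real a + comb_index s + 30)\<^sup>2 \<le> (200 * (201 / 200) ^ ?n)\<^sup>2"
    by (intro power_mono) simp_all
  also have "\<dots> = 40000 * ((201 / 200)\<^sup>2) ^ ?n"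
    unfolding power_mult_distrib power_mult[symmetric] by (simp add: mult.commute)
  also have "\<dots> = 40000 * (40401 / 40000) ^ ?n"
    by (simp add: power2_eq_square)
  also have "\<dots> = 40000 * (40401 / 40000) ^ a * (40401 / 40000) ^ comb_index s"
    by (simp add: power_add)
  also have "\<dots> \<le> 40000 * (40401 / 40000) ^ a * growth (comb_index s)"
    unfolding growth_def by (intro mult_left_mono power_mono) simp_all
  also have "\<dots> \<le> 40000 * (40401 / 40000) ^ a * (3 * decay_weight s)"
    by (intro mult_left_mono decay_weight_lower) simp
  finally show ?thesis by simp
qed

lemma moment_sums:
  fixes H :: "state \<Rightarrow> nat \<Rightarrow> real"
  assumes "\<And>s a. succ s = [] \<Longrightarrow> H s a = f a"
    and "\<And>s a. succ s \<noteq> [] \<Longrightarrow> H s a = mean_list (\<lambda>t. H t (Suc a)) (succ s)"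
    and "\<And>s a. \<bar>H s a\<bar> \<le> (real a + comb_index s + 30)\<^sup>2"
  shows "(\<lambda>i. f i * exit_prob succ i s) sums H s 0"
proof -
  have "(\<lambda>i. f (0 + i) * exit_prob succ i s) sums H s 0"
  proof (rule exit_prob_sums[where W = decay_weight and \<rho> = "51 / 50" and \<mu> = "40401 / 40000" and K = 120000])
    show "\<bar>H s a\<bar> \<le> 120000 * (40401 / 40000) ^ a * decay_weight s" for s a
      using assms(3) moment_bound by (rule order_trans)
  qed (fact assms(1) assms(2) decay_weight_step | simp)+
  then show ?thesis by simp
qed

lemma exited_values:
  assumes "succ s = []"
  shows "exit_mean s = 0" "exit_second_moment s = 0"
  using assms by (induction s rule: state_cases) simp_all

lemma exit_prob_sums_1: "(\<lambda>i. exit_prob succ i s) sums 1"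
proof -
  have "(\<lambda>i. 1 * exit_prob succ i s) sums 1"
    by (rule moment_sums[where f = "\<lambda>_. 1" and H = "\<lambda>_ _. 1"])
      (simp_all add: mean_list_const one_le_power)
  then show ?thesis by simp
qed

text \<open>
  The candidate \<open>H s a\<close> is the moment of \<open>a + T\<close>, where \<open>T\<close> is the exit time from \<open>s\<close>,
  in this lemma and the next.
\<close>

lemma exit_prob_sums_mean: "(\<lambda>i. real i * exit_prob succ i s) sums exit_mean s"
proof -
  have "(\<lambda>i. real i * exit_prob succ i s) sums (real 0 + exit_mean s)"
  proof (rule moment_sums[where H = "\<lambda>s a. real a + exit_mean s"])
    fix s a
    show "real a + exit_mean s = real a" if "succ s = []" using that by (simp add: exited_values)
    show "real a + exit_mean s = mean_list (\<lambda>t. real (Suc a) + exit_mean t) (succ s)" if "succ s \<noteq> []"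
      unfolding exit_mean_step[OF that] using that by (simp add: mean_list_add mean_list_const)
    have "real a + exit_mean s \<le> real a + comb_index s + 30" using exit_mean_bound[of s] by simp
    also have "\<dots> \<le> (real a + comb_index s + 30)\<^sup>2" by (rule self_le_power) simp_all
    finally show "\<bar>real a + exit_mean s\<bar> \<le> (real a + comb_index s + 30)\<^sup>2"
      using exit_mean_bound[of s] by simp
  qed
  then show ?thesis by simp
qed

lemma exit_prob_sums_second_moment:
  "(\<lambda>i. (real i)\<^sup>2 * exit_prob succ i s) sums exit_second_moment s"
proof -
  let ?H = "\<lambda>s a. (real a)\<^sup>2 + 2 * real a * exit_mean s + exit_second_moment s"
  have "(\<lambda>i. (real i)\<^sup>2 * exit_prob succ i s) sums ?H s 0"
  proof (rule moment_sums[where H = ?H])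
    fix s a
    show "?H s a = (real a)\<^sup>2" if "succ s = []" using that by (simp add: exited_values)
    show "?H s a = mean_list (\<lambda>t. ?H t (Suc a)) (succ s)" if "succ s \<noteq> []"
    proof -
      have split: "?H t (Suc a) = (real a)\<^sup>2 + 2 * real a * (1 + exit_mean t)
          + (1 + 2 * exit_mean t + exit_second_moment t)" for t
        by (simp add: power2_eq_square algebra_simps)
      have "mean_list (\<lambda>t. ?H t (Suc a)) (succ s)
          = mean_list (\<lambda>t. (real a)\<^sup>2) (succ s)
            + 2 * real a * mean_list (\<lambda>t. 1 + exit_mean t) (succ s)
            + mean_list (\<lambda>t. 1 + 2 * exit_mean t + exit_second_moment t) (succ s)"
        by (simp only: split mean_list_add mean_list_mult_left)
      also have "\<dots> = ?H s a"
        by (simp only: exit_mean_step[OF that, symmetric] exit_second_moment_step[OF that, symmetric]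
            mean_list_const[OF that])
      finally show ?thesis by simp
    qed
    have "?H s a \<le> (real a)\<^sup>2 + 2 * real a * (comb_index s + 30) + (real (comb_index s + 30))\<^sup>2"
      using exit_mean_bound[of s] exit_second_moment_bound[of s]
      by (intro add_mono mult_left_mono) simp_all
    also have "\<dots> = (real a + comb_index s + 30)\<^sup>2" by (simp add: power2_eq_square algebra_simps)
    finally show "\<bar>?H s a\<bar> \<le> (real a + comb_index s + 30)\<^sup>2"
      using exit_mean_bound[of s] exit_second_moment_bound[of s] by simp
  qed
  then show ?thesis by simp
qed

section \<open>Expectation and variance of the walk length\<close>

lemma measure_spmf_eq_density: "measure_spmf p = density (count_space UNIV) (spmf p)"
proof (rule measure_eqI)
  fix A assume "A \<in> sets (measure_spmf p)"
  have "emeasure (measure_spmf p) A = (\<integral>\<^sup>+x. indicator A x \<partial>measure_spmf p)" by simp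
  also have "\<dots> = (\<integral>\<^sup>+x. ennreal (spmf p x) * indicator A x \<partial>count_space UNIV)"
    by (rule nn_integral_measure_spmf)
  also have "\<dots> = emeasure (density (count_space UNIV) (spmf p)) A"
    by (simp add: emeasure_density)
  finally show "emeasure (measure_spmf p) A = emeasure (density (count_space UNIV) (spmf p)) A" .
qed simp

lemma integral_measure_spmf_nat:
  fixes f :: "nat \<Rightarrow> real"
  assumes sums: "(\<lambda>n. f n * spmf T n) sums x" and nonneg: "\<And>n. 0 \<le> f n"
  shows "integrable (measure_spmf T) f" "integral\<^sup>L (measure_spmf T) f = x"
proof -
  have int: "integrable (count_space UNIV) (\<lambda>n. spmf T n *\<^sub>R f n)"
    using sums nonneg by (auto simp: integrable_count_space_nat_iff mult_ac sums_iff)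
  then show "integrable (measure_spmf T) f"
    by (simp add: measure_spmf_eq_density integrable_density)
  have "integral\<^sup>L (measure_spmf T) f = (\<integral>n. spmf T n *\<^sub>R f n \<partial>count_space UNIV)"
    by (simp add: measure_spmf_eq_density integral_density)
  also have "\<dots> = x"
    using sums integral_count_space_nat[OF int] by (simp add: mult_ac sums_iff)
  finally show "integral\<^sup>L (measure_spmf T) f = x" .
qed

lemma walk_state_start:
  assumes "v \<in> tri_ladder_verts"
  shows "walk_state [v] Start"
  using assms by (auto simp: tri_ladder_verts_eq walk_state_def)

theorem corollary2p46:
  fixes v :: "int \<times> int" and T :: "nat spmf"
  assumes "v \<in> tri_ladder_verts"
  defines "T \<equiv> gsaw_steps tri_ladder_verts tri_ladder_adj v"
  shows "lossless_spmf T
    \<and> integrable (measure_spmf T) real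
    \<and> integrable (measure_spmf T) (\<lambda>n. (real n)\<^sup>2)
    \<and> prob_space.expectation (measure_spmf T) real = 941 / 48
    \<and> prob_space.variance (measure_spmf T) real = 51919 / 256
    \<and> \<bar>prob_space.expectation (measure_spmf T) real - 19.6\<bar> < 0.05
    \<and> \<bar>prob_space.variance (measure_spmf T) real - 202.8\<bar> < 0.05
    \<and> \<bar>sqrt (prob_space.variance (measure_spmf T) real) - 14.2\<bar> < 0.05"
proof -
  have "T = remaining_steps tri_ladder_verts tri_ladder_adj [v]"
    by (simp add: T_def gsaw_steps_def gsaw_def remaining_steps_def)
  then have law: "spmf T n = exit_prob succ n Start" for n
    using spmf_remaining_steps[where R = walk_state, OF walk_state_succ walk_state_start] assms(1) by simp
  have "(\<lambda>n. 1 * spmf T n) sums 1" "(\<lambda>n. real n * spmf T n) sums (941 / 48)"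
    "(\<lambda>n. (real n)\<^sup>2 * spmf T n) sums (84547 / 144)"
    using exit_prob_sums_1[of Start] exit_prob_sums_mean[of Start]
      exit_prob_sums_second_moment[of Start]
    by (simp_all add: law)
  from this[THEN integral_measure_spmf_nat(2)] this[THEN integral_measure_spmf_nat(1)]
  have total: "integral\<^sup>L (measure_spmf T) (\<lambda>_. 1) = (1 :: real)"
    and mean: "integrable (measure_spmf T) real" "integral\<^sup>L (measure_spmf T) real = 941 / 48"
    and square: "integrable (measure_spmf T) (\<lambda>n. (real n)\<^sup>2)"
      "integral\<^sup>L (measure_spmf T) (\<lambda>n. (real n)\<^sup>2) = 84547 / 144"
    by simp_all
  have lossless: "lossless_spmf T"
    using total by (simp add: lossless_spmf_def weight_spmf_def)
  interpret prob_space "measure_spmf T"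
    using total by (intro prob_spaceI) (simp add: measure_spmf.emeasure_eq_measure)
  have variance: "variance real = 51919 / 256"
    by (subst variance_eq[OF mean(1) square(1)])
      (simp only: mean(2) square(2), simp add: power2_eq_square)
  have "283 / 20 < sqrt (51919 / 256 :: real)"
    by (rule real_less_rsqrt) (simp add: power2_eq_square)
  moreover have "sqrt (51919 / 256 :: real) < 57 / 4"
    by (rule real_less_lsqrt) (simp_all add: power2_eq_square)
  ultimately have deviation: "\<bar>sqrt (51919 / 256) - 71 / 5\<bar> < (1 / 20 :: real)"
    by linarith
  show ?thesis
    unfolding variance using lossless mean square deviation by simp
qed

end
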